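(* Let $k$ be a commutative ring with identity, let $I$ and $B$ be pre-Lie $k$-algebras, and let $(\lambda,\rho)$ be a pair of $k$-linear mappings $B\to\operatorname{End}(I_k)$, written $b\mapsto\lambda_b$ and $b\mapsto\rho_b$, such that: (a) $\lambda\colon(B,\cdot)\to(\operatorname{End}(I_k),\circ)$ is a pre-morphism, i.e. $\lambda_{a\cdot b}-\lambda_a\circ\lambda_b=\lambda_{b\cdot a}-\lambda_b\circ\lambda_a$ for every $a,b\in B$; (b) $\rho_a\circ\lambda_b-\lambda_b\circ\rho_a=\rho_a\circ\rho_b-\rho_{b\cdot a}$ for every $a,b\in B$; (c) $\lambda_a(i)\cdot j-\lambda_a(i\cdot j)=\rho_a(i)\cdot j-i\cdot\lambda_a(j)$ for every $a\in B$ and $i,j\in I$; (d) $\rho_a(i\cdot j)-i\cdot\rho_a(j)=\rho_a(j\cdot i)-j\cdot\rho_a(i)$ for every $a\in B$ and $i,j\in I$. On the $k$-module direct sum $I\oplus B$ define a multiplication $*$ by $$(i,b)*(j,c)=(i\cdot j+\lambda_b(j)+\rho_c(i),\ b\cdot c)$$ for every $(i,b),(j,c)\in I\oplus B$. Then $(I\oplus B,* )$ is a pre-Lie $k$-algebra.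
   Context: A $k$-algebra is a $k$-module with a $k$-bilinear multiplication (not necessarily associative). A pre-Lie $k$-algebra is a $k$-algebra $(A,\cdot)$ with $(x\cdot y)\cdot z-x\cdot(y\cdot z)=(y\cdot x)\cdot z-y\cdot(x\cdot z)$ for all $x,y,z\in A$. $\operatorname{End}(I_k)$ denotes the set of all $k$-module endomorphisms of the underlying $k$-module of $I$. *)

theory Defs
  imports "HOL-Algebra.Module"
begin

text \<open>
  The record type of \<open>module\<close> extends that of rings, so it already carries a multiplication;
  the locale \<open>module\<close> leaves it (and the field \<open>one\<close>) unconstrained. A nonassociative algebra
  is therefore such a record whose multiplication is closed and bilinear; \<open>one\<close> is never used.
\<close>

locale nonassoc_algebra = module R A for R (structure) and A (structure) +
  assumes mult_closed:
      "\<lbrakk>x \<in> carrier A; y \<in> carrier A\<rbrakk> \<Longrightarrow> x \<otimes>\<^bsub>A\<^esub> y \<in> carrier A"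
    and mult_add_left:
      "\<lbrakk>x \<in> carrier A; y \<in> carrier A; z \<in> carrier A\<rbrakk> \<Longrightarrow>
        (x \<oplus>\<^bsub>A\<^esub> y) \<otimes>\<^bsub>A\<^esub> z = x \<otimes>\<^bsub>A\<^esub> z \<oplus>\<^bsub>A\<^esub> y \<otimes>\<^bsub>A\<^esub> z"
    and mult_add_right:
      "\<lbrakk>x \<in> carrier A; y \<in> carrier A; z \<in> carrier A\<rbrakk> \<Longrightarrow>
        z \<otimes>\<^bsub>A\<^esub> (x \<oplus>\<^bsub>A\<^esub> y) = z \<otimes>\<^bsub>A\<^esub> x \<oplus>\<^bsub>A\<^esub> z \<otimes>\<^bsub>A\<^esub> y"
    and mult_smult_left:
      "\<lbrakk>r \<in> carrier R; x \<in> carrier A; y \<in> carrier A\<rbrakk> \<Longrightarrow>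
        (r \<odot>\<^bsub>A\<^esub> x) \<otimes>\<^bsub>A\<^esub> y = r \<odot>\<^bsub>A\<^esub> (x \<otimes>\<^bsub>A\<^esub> y)"
    and mult_smult_right:
      "\<lbrakk>r \<in> carrier R; x \<in> carrier A; y \<in> carrier A\<rbrakk> \<Longrightarrow>
        x \<otimes>\<^bsub>A\<^esub> (r \<odot>\<^bsub>A\<^esub> y) = r \<odot>\<^bsub>A\<^esub> (x \<otimes>\<^bsub>A\<^esub> y)"

locale pre_lie_algebra = nonassoc_algebra +
  assumes pre_lie:
      "\<lbrakk>x \<in> carrier A; y \<in> carrier A; z \<in> carrier A\<rbrakk> \<Longrightarrow>
        (x \<otimes>\<^bsub>A\<^esub> y) \<otimes>\<^bsub>A\<^esub> z \<ominus>\<^bsub>A\<^esub> x \<otimes>\<^bsub>A\<^esub> (y \<otimes>\<^bsub>A\<^esub> z) =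
        (y \<otimes>\<^bsub>A\<^esub> x) \<otimes>\<^bsub>A\<^esub> z \<ominus>\<^bsub>A\<^esub> y \<otimes>\<^bsub>A\<^esub> (x \<otimes>\<^bsub>A\<^esub> z)"

definition linear_maps ::
  "('k, 'l) ring_scheme \<Rightarrow> ('k, 'a, 'm) module_scheme \<Rightarrow> ('k, 'b, 'n) module_scheme \<Rightarrow> ('a \<Rightarrow> 'b) set"
  where "linear_maps R M N =
    {f \<in> carrier M \<rightarrow> carrier N.
      (\<forall>x \<in> carrier M. \<forall>y \<in> carrier M. f (x \<oplus>\<^bsub>M\<^esub> y) = f x \<oplus>\<^bsub>N\<^esub> f y) \<and>
      (\<forall>r \<in> carrier R. \<forall>x \<in> carrier M. f (r \<odot>\<^bsub>M\<^esub> x) = r \<odot>\<^bsub>N\<^esub> f x)}"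

text \<open>
  Endomorphisms are taken extensional (\<open>undefined\<close> off the carrier), so that two of them are
  equal as HOL functions exactly when they agree on the carrier.
\<close>

definition End_alg ::
  "('k, 'l) ring_scheme \<Rightarrow> ('k, 'a, 'm) module_scheme \<Rightarrow> ('k, 'a \<Rightarrow> 'a) module"
  where "End_alg R M =
    \<lparr>carrier = linear_maps R M M \<inter> extensional (carrier M),
     mult = compose (carrier M),
     one = (\<lambda>x \<in> carrier M. x),
     zero = (\<lambda>x \<in> carrier M. \<zero>\<^bsub>M\<^esub>),
     add = (\<lambda>f g. \<lambda>x \<in> carrier M. f x \<oplus>\<^bsub>M\<^esub> g x),
     smult = (\<lambda>r f. \<lambda>x \<in> carrier M. r \<odot>\<^bsub>M\<^esub> f x)\<rparr>"

definition pre_morphism ::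
  "('k, 'a, 'm) module_scheme \<Rightarrow> ('k, 'b, 'n) module_scheme \<Rightarrow> ('a \<Rightarrow> 'b) \<Rightarrow> bool"
  where "pre_morphism A A' f \<longleftrightarrow>
    (\<forall>x \<in> carrier A. \<forall>y \<in> carrier A.
      f (x \<otimes>\<^bsub>A\<^esub> y) \<ominus>\<^bsub>A'\<^esub> f x \<otimes>\<^bsub>A'\<^esub> f y =
      f (y \<otimes>\<^bsub>A\<^esub> x) \<ominus>\<^bsub>A'\<^esub> f y \<otimes>\<^bsub>A'\<^esub> f x)"

definition semidirect_sum ::
  "('k, 'i, 'm) module_scheme \<Rightarrow> ('k, 'b, 'n) module_scheme \<Rightarrow>
   ('b \<Rightarrow> 'i \<Rightarrow> 'i) \<Rightarrow> ('b \<Rightarrow> 'i \<Rightarrow> 'i) \<Rightarrow> ('k, 'i \<times> 'b) module"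
  where "semidirect_sum I B lam rho =
    \<lparr>carrier = carrier I \<times> carrier B,
     mult = (\<lambda>(i, b) (j, c). (i \<otimes>\<^bsub>I\<^esub> j \<oplus>\<^bsub>I\<^esub> lam b j \<oplus>\<^bsub>I\<^esub> rho c i, b \<otimes>\<^bsub>B\<^esub> c)),
     one = (\<one>\<^bsub>I\<^esub>, \<one>\<^bsub>B\<^esub>),
     zero = (\<zero>\<^bsub>I\<^esub>, \<zero>\<^bsub>B\<^esub>),
     add = (\<lambda>(i, b) (j, c). (i \<oplus>\<^bsub>I\<^esub> j, b \<oplus>\<^bsub>B\<^esub> c)),
     smult = (\<lambda>r (i, b). (r \<odot>\<^bsub>I\<^esub> i, r \<odot>\<^bsub>B\<^esub> b))\<rparr>"

end

theory Submission
  imports Defs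
begin

text \<open>
  Group the \<open>I\<close>-component of the associator of \<open>(i, a), (j, b), (l, c)\<close> as a sum of seven
  differences. Exchanging \<open>(i, a)\<close> and \<open>(j, b)\<close> fixes three of them, by the pre-Lie identity
  of \<open>I\<close>, (a) and (d), and interchanges the other four in two pairs, by (c) and (b).
\<close>

lemma linear_mapsD:
  assumes "f \<in> linear_maps R M N"
  shows "x \<in> carrier M \<Longrightarrow> f x \<in> carrier N"
    and "\<lbrakk>x \<in> carrier M; y \<in> carrier M\<rbrakk> \<Longrightarrow> f (x \<oplus>\<^bsub>M\<^esub> y) = f x \<oplus>\<^bsub>N\<^esub> f y"
    and "\<lbrakk>r \<in> carrier R; x \<in> carrier M\<rbrakk> \<Longrightarrow> f (r \<odot>\<^bsub>M\<^esub> x) = r \<odot>\<^bsub>N\<^esub> f x"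
  using assms by (auto simp: linear_maps_def)

lemma (in module) uminus_linear_map:
  assumes "f \<in> linear_maps R M M"
  shows "(\<lambda>x \<in> carrier M. \<ominus>\<^bsub>M\<^esub> f x) \<in> linear_maps R M M"
  using assms by (auto simp: linear_maps_def Pi_iff M.minus_add smult_r_minus)

lemma (in module) add_linear_maps:
  assumes "f \<in> linear_maps R M M" and "g \<in> linear_maps R M M"
  shows "(\<lambda>x \<in> carrier M. f x \<oplus>\<^bsub>M\<^esub> g x) \<in> linear_maps R M M"
  using assms by (auto simp: linear_maps_def Pi_iff M.a_ac smult_r_distr)

text \<open>Conditions (a) and (b) subtract inside \<open>End_alg\<close>, and that difference is
  defined through additive inverses. The group axioms make these inverses unique, so that they can
  be computed.\<close>

lemma (in module) End_alg_abelian_group: "abelian_group (End_alg R M)"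
proof (rule abelian_groupI, goal_cases)
  case (1 f g)
  then show ?case
    using add_linear_maps[of f g] by (simp add: End_alg_def)
next
  case 2
  show ?case
    by (auto simp: End_alg_def linear_maps_def)
next
  case (3 f g h)
  then show ?case
    by (auto simp: End_alg_def linear_maps_def Pi_iff M.a_assoc intro!: restrict_ext)
next
  case (4 f g)
  then show ?case
    by (auto simp: End_alg_def linear_maps_def Pi_iff M.a_comm intro!: restrict_ext)
next
  case (5 f)
  then show ?case
    \<comment> \<open>Here one side is \<open>f\<close> itself and not a visible restriction, so the
      extensionality of \<open>f\<close> has to be used.\<close>
    by (auto simp: End_alg_def linear_maps_def Pi_iff intro!: extensionalityI[where A = "carrier M"])
next
  case (6 f)
  then have f: "f \<in> linear_maps R M M"
    by (simp add: End_alg_def)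
  show ?case
    using uminus_linear_map[OF f] linear_mapsD(1)[OF f]
    by (intro bexI[where x = "\<lambda>x \<in> carrier M. \<ominus>\<^bsub>M\<^esub> f x"])
      (auto simp: End_alg_def M.l_neg intro!: restrict_ext)
qed

text \<open>The restricted pointwise negative of \<open>g\<close> is a left inverse of
  \<open>g\<close>, hence is the negative of \<open>g\<close> by uniqueness of inverses. This lets
  the operator identities be evaluated at a point.\<close>

lemma (in module) End_alg_minus_apply:
  assumes f: "f \<in> carrier (End_alg R M)" and g: "g \<in> carrier (End_alg R M)" and x: "x \<in> carrier M"
  shows "(f \<ominus>\<^bsub>End_alg R M\<^esub> g) x = f x \<ominus>\<^bsub>M\<^esub> g x"
proof -
  interpret E: abelian_group "End_alg R M"
    by (rule End_alg_abelian_group)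
  have g': "g \<in> linear_maps R M M"
    using g by (simp add: End_alg_def)
  have "\<ominus>\<^bsub>End_alg R M\<^esub> g = (\<lambda>x \<in> carrier M. \<ominus>\<^bsub>M\<^esub> g x)"
    using uminus_linear_map[OF g'] linear_mapsD(1)[OF g'] g
    by (intro E.minus_equality) (auto simp: End_alg_def M.l_neg intro!: restrict_ext)
  then show ?thesis
    \<comment> \<open>The equation for the negative is applied while \<open>End_alg\<close> is still
      folded; only then is the sum unfolded pointwise.\<close>
    using x by (simp add: a_minus_def) (simp add: End_alg_def)
qed

lemma (in module) End_alg_mult_closed:
  assumes "f \<in> carrier (End_alg R M)" and "g \<in> carrier (End_alg R M)"
  shows "f \<otimes>\<^bsub>End_alg R M\<^esub> g \<in> carrier (End_alg R M)"
  using assms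
  by (auto simp: End_alg_def linear_maps_def compose_def Pi_iff)

lemma End_alg_mult_apply:
  "x \<in> carrier M \<Longrightarrow> (f \<otimes>\<^bsub>End_alg R M\<^esub> g) x = f (g x)"
  by (simp add: End_alg_def compose_def)

text \<open>Used from right to left, this merges a sum of differences into a single difference of
  two sums, whose terms can then be matched up to order.\<close>

lemma (in abelian_group) minus_add_add:
  "\<lbrakk>u \<in> carrier G; v \<in> carrier G; w \<in> carrier G; z \<in> carrier G\<rbrakk> \<Longrightarrow>
    (u \<oplus> v) \<ominus> (w \<oplus> z) = (u \<ominus> w) \<oplus> (v \<ominus> z)"
  by (simp add: a_minus_def minus_add a_ac)

text \<open>There are two sources of linearity: \<open>f b\<close> is an endomorphism, which makes
  \<open>f b i\<close> linear in \<open>i\<close>, and \<open>f\<close> itself is linear, which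
  after evaluation at \<open>i\<close> makes it linear in \<open>b\<close>.\<close>

lemma linear_maps_End_algD:
  assumes f: "f \<in> linear_maps R B (End_alg R M)" and b: "b \<in> carrier B"
  shows "f b \<in> carrier (End_alg R M)"
    and "i \<in> carrier M \<Longrightarrow> f b i \<in> carrier M"
    and "\<lbrakk>i \<in> carrier M; j \<in> carrier M\<rbrakk> \<Longrightarrow> f b (i \<oplus>\<^bsub>M\<^esub> j) = f b i \<oplus>\<^bsub>M\<^esub> f b j"
    and "\<lbrakk>r \<in> carrier R; i \<in> carrier M\<rbrakk> \<Longrightarrow> f b (r \<odot>\<^bsub>M\<^esub> i) = r \<odot>\<^bsub>M\<^esub> f b i"
    and "\<lbrakk>c \<in> carrier B; i \<in> carrier M\<rbrakk> \<Longrightarrow> f (b \<oplus>\<^bsub>B\<^esub> c) i = f b i \<oplus>\<^bsub>M\<^esub> f c i"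
    and "\<lbrakk>r \<in> carrier R; i \<in> carrier M\<rbrakk> \<Longrightarrow> f (r \<odot>\<^bsub>B\<^esub> b) i = r \<odot>\<^bsub>M\<^esub> f b i"
proof -
  show "f b \<in> carrier (End_alg R M)"
    using linear_mapsD(1)[OF f b] .
  then have "f b \<in> linear_maps R M M"
    by (simp add: End_alg_def)
  note lin = linear_mapsD[OF this]
  show "i \<in> carrier M \<Longrightarrow> f b i \<in> carrier M"
    "\<lbrakk>i \<in> carrier M; j \<in> carrier M\<rbrakk> \<Longrightarrow> f b (i \<oplus>\<^bsub>M\<^esub> j) = f b i \<oplus>\<^bsub>M\<^esub> f b j"
    "\<lbrakk>r \<in> carrier R; i \<in> carrier M\<rbrakk> \<Longrightarrow> f b (r \<odot>\<^bsub>M\<^esub> i) = r \<odot>\<^bsub>M\<^esub> f b i"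
    by (fact lin)+
  show "\<lbrakk>c \<in> carrier B; i \<in> carrier M\<rbrakk> \<Longrightarrow> f (b \<oplus>\<^bsub>B\<^esub> c) i = f b i \<oplus>\<^bsub>M\<^esub> f c i"
    using linear_mapsD(2)[OF f b] by (simp add: End_alg_def)
  show "\<lbrakk>r \<in> carrier R; i \<in> carrier M\<rbrakk> \<Longrightarrow> f (r \<odot>\<^bsub>B\<^esub> b) i = r \<odot>\<^bsub>M\<^esub> f b i"
    using linear_mapsD(3)[OF f _ b] by (simp add: End_alg_def)
qed

text \<open>The maps \<open>lam\<close> and \<open>rho\<close> enter only the multiplication, so
  they are arbitrary here and every module axiom is checked componentwise.\<close>

lemma semidirect_sum_module:
  fixes I :: "('k, 'i, 'm) module_scheme" and B :: "('k, 'b, 'n) module_scheme"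
  assumes "module k I" and "module k B"
  shows "module k (semidirect_sum I B lam rho)"
proof -
  interpret I: module k I by fact
  interpret B: module k B by fact
  have "abelian_group (semidirect_sum I B lam rho)"
  proof (rule abelian_groupI, goal_cases)
    case (6 x)
    then show ?case
      by (intro bexI[where x = "(\<ominus>\<^bsub>I\<^esub> fst x, \<ominus>\<^bsub>B\<^esub> snd x)"])
        (auto simp: semidirect_sum_def I.M.l_neg B.M.l_neg)
  qed (auto simp: semidirect_sum_def I.M.a_ac B.M.a_ac)
  then show ?thesis
    by (intro moduleI I.is_cring)
      (auto simp: semidirect_sum_def I.smult_l_distr I.smult_r_distr I.smult_assoc1
        B.smult_l_distr B.smult_r_distr B.smult_assoc1)
qed

text \<open>Uniqueness of inverses identifies the negative with the componentwise one; the
  associator identity thereby splits into an \<open>I\<close>-part and a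
  \<open>B\<close>-part.\<close>

lemma semidirect_sum_minus:
  assumes "module k I" and "module k B"
    and "i \<in> carrier I" "b \<in> carrier B" "j \<in> carrier I" "c \<in> carrier B"
  shows "(i, b) \<ominus>\<^bsub>semidirect_sum I B lam rho\<^esub> (j, c) = (i \<ominus>\<^bsub>I\<^esub> j, b \<ominus>\<^bsub>B\<^esub> c)"
proof -
  interpret I: module k I by fact
  interpret B: module k B by fact
  interpret S: module k "semidirect_sum I B lam rho"
    by (rule semidirect_sum_module) fact+
  have "\<ominus>\<^bsub>semidirect_sum I B lam rho\<^esub> (j, c) = (\<ominus>\<^bsub>I\<^esub> j, \<ominus>\<^bsub>B\<^esub> c)"
    using assms
    by (intro S.M.minus_equality) (auto simp: semidirect_sum_def I.M.l_neg B.M.l_neg)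
  then show ?thesis
    by (simp add: a_minus_def) (simp add: semidirect_sum_def)
qed

theorem theorem16:
  fixes k :: "('k, 'l) ring_scheme"
    and I :: "('k, 'i, 'm) module_scheme"
    and B :: "('k, 'b, 'n) module_scheme"
    and lam rho :: "'b \<Rightarrow> 'i \<Rightarrow> 'i"
  assumes "cring k"
    and "pre_lie_algebra k I"
    and "pre_lie_algebra k B"
    and "lam \<in> linear_maps k B (End_alg k I)"
    and "rho \<in> linear_maps k B (End_alg k I)"
    and a: "pre_morphism B (End_alg k I) lam"
    and b: "\<And>a b. \<lbrakk>a \<in> carrier B; b \<in> carrier B\<rbrakk> \<Longrightarrow>
      rho a \<otimes>\<^bsub>End_alg k I\<^esub> lam b \<ominus>\<^bsub>End_alg k I\<^esub> lam b \<otimes>\<^bsub>End_alg k I\<^esub> rho a =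
      rho a \<otimes>\<^bsub>End_alg k I\<^esub> rho b \<ominus>\<^bsub>End_alg k I\<^esub> rho (b \<otimes>\<^bsub>B\<^esub> a)"
    and c: "\<And>a i j. \<lbrakk>a \<in> carrier B; i \<in> carrier I; j \<in> carrier I\<rbrakk> \<Longrightarrow>
      lam a i \<otimes>\<^bsub>I\<^esub> j \<ominus>\<^bsub>I\<^esub> lam a (i \<otimes>\<^bsub>I\<^esub> j) =
      rho a i \<otimes>\<^bsub>I\<^esub> j \<ominus>\<^bsub>I\<^esub> i \<otimes>\<^bsub>I\<^esub> lam a j"
    and d: "\<And>a i j. \<lbrakk>a \<in> carrier B; i \<in> carrier I; j \<in> carrier I\<rbrakk> \<Longrightarrow>
      rho a (i \<otimes>\<^bsub>I\<^esub> j) \<ominus>\<^bsub>I\<^esub> i \<otimes>\<^bsub>I\<^esub> rho a j =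
      rho a (j \<otimes>\<^bsub>I\<^esub> i) \<ominus>\<^bsub>I\<^esub> j \<otimes>\<^bsub>I\<^esub> rho a i"
  shows "pre_lie_algebra k (semidirect_sum I B lam rho)"
proof -
  interpret I: pre_lie_algebra k I by fact
  interpret B: pre_lie_algebra k B by fact
  let ?E = "End_alg k I" and ?S = "semidirect_sum I B lam rho"
  have mI: "module k I" and mB: "module k B"
    by unfold_locales
  note lam = linear_maps_End_algD[OF \<open>lam \<in> linear_maps k B ?E\<close>]
    and rho = linear_maps_End_algD[OF \<open>rho \<in> linear_maps k B ?E\<close>]
  note closed = lam(1,2) rho(1,2) I.mult_closed B.mult_closed I.End_alg_mult_closed
  note E_apply = I.End_alg_minus_apply End_alg_mult_apply closed
  \<comment> \<open>Conditions (a) and (b) equate endomorphisms; applying both sides to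
    \<open>i\<close> gives the equations in \<open>I\<close> that the associator computation
    needs.\<close>
  have a': "lam (a \<otimes>\<^bsub>B\<^esub> b) i \<ominus>\<^bsub>I\<^esub> lam a (lam b i) = lam (b \<otimes>\<^bsub>B\<^esub> a) i \<ominus>\<^bsub>I\<^esub> lam b (lam a i)"
    if [simp]: "a \<in> carrier B" "b \<in> carrier B" "i \<in> carrier I" for a b i
  proof -
    have "(lam (a \<otimes>\<^bsub>B\<^esub> b) \<ominus>\<^bsub>?E\<^esub> lam a \<otimes>\<^bsub>?E\<^esub> lam b) i = (lam (b \<otimes>\<^bsub>B\<^esub> a) \<ominus>\<^bsub>?E\<^esub> lam b \<otimes>\<^bsub>?E\<^esub> lam a) i"
      using a by (simp add: pre_morphism_def)
    then show ?thesis
      by (simp add: E_apply)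
  qed
  have b': "rho a (lam b i) \<ominus>\<^bsub>I\<^esub> lam b (rho a i) = rho a (rho b i) \<ominus>\<^bsub>I\<^esub> rho (b \<otimes>\<^bsub>B\<^esub> a) i"
    if [simp]: "a \<in> carrier B" "b \<in> carrier B" "i \<in> carrier I" for a b i
    using arg_cong[OF b[of a b], of "\<lambda>f. f i"]
    by (simp add: E_apply)
  have S: "carrier ?S = carrier I \<times> carrier B"
    "(i, b) \<otimes>\<^bsub>?S\<^esub> (j, c) = (i \<otimes>\<^bsub>I\<^esub> j \<oplus>\<^bsub>I\<^esub> lam b j \<oplus>\<^bsub>I\<^esub> rho c i, b \<otimes>\<^bsub>B\<^esub> c)"
    "(i, b) \<oplus>\<^bsub>?S\<^esub> (j, c) = (i \<oplus>\<^bsub>I\<^esub> j, b \<oplus>\<^bsub>B\<^esub> c)"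
    "r \<odot>\<^bsub>?S\<^esub> (i, b) = (r \<odot>\<^bsub>I\<^esub> i, r \<odot>\<^bsub>B\<^esub> b)" for i b j c r
    by (simp_all add: semidirect_sum_def)
  have "nonassoc_algebra k ?S"
    by (intro nonassoc_algebra.intro nonassoc_algebra_axioms.intro semidirect_sum_module mI mB)
      (auto simp: S lam(2-) rho(2-) I.mult_closed B.mult_closed I.mult_add_left I.mult_add_right
        I.mult_smult_left I.mult_smult_right B.mult_add_left B.mult_add_right
        B.mult_smult_left B.mult_smult_right I.smult_r_distr I.M.a_ac)
  moreover have "pre_lie_algebra_axioms ?S"
  proof (rule pre_lie_algebra_axioms.intro)
    fix x y z
    assume "x \<in> carrier ?S" "y \<in> carrier ?S" "z \<in> carrier ?S"
    then obtain i a j b l c where xyz: "x = (i, a)" "y = (j, b)" "z = (l, c)"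
      and [simp]: "i \<in> carrier I" "j \<in> carrier I" "l \<in> carrier I"
        "a \<in> carrier B" "b \<in> carrier B" "c \<in> carrier B"
      by (auto simp: S)
    \<comment> \<open>The variables are generalised because the formula is used twice, the second
      time with \<open>(i, a)\<close> and \<open>(j, b)\<close> exchanged. The fourth summand pairs
      the left side of (c) for \<open>a\<close>, \<open>j\<close>, \<open>l\<close> with its right
      side for \<open>b\<close>, \<open>i\<close>, \<open>l\<close>. The fifth pairs the left side
      of (b) for \<open>c\<close>, \<open>a\<close> at \<open>j\<close> with its right side for
      \<open>c\<close>, \<open>b\<close> at \<open>i\<close>.\<close>
    have expand: "((i, a) \<otimes>\<^bsub>?S\<^esub> (j, b)) \<otimes>\<^bsub>?S\<^esub> (l, c) \<ominus>\<^bsub>?S\<^esub> (i, a) \<otimes>\<^bsub>?S\<^esub> ((j, b) \<otimes>\<^bsub>?S\<^esub> (l, c)) =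
      (((i \<otimes>\<^bsub>I\<^esub> j) \<otimes>\<^bsub>I\<^esub> l \<ominus>\<^bsub>I\<^esub> i \<otimes>\<^bsub>I\<^esub> (j \<otimes>\<^bsub>I\<^esub> l)) \<oplus>\<^bsub>I\<^esub>
        (lam (a \<otimes>\<^bsub>B\<^esub> b) l \<ominus>\<^bsub>I\<^esub> lam a (lam b l)) \<oplus>\<^bsub>I\<^esub>
        (rho c (i \<otimes>\<^bsub>I\<^esub> j) \<ominus>\<^bsub>I\<^esub> i \<otimes>\<^bsub>I\<^esub> rho c j) \<oplus>\<^bsub>I\<^esub>
        ((lam a j \<otimes>\<^bsub>I\<^esub> l \<ominus>\<^bsub>I\<^esub> lam a (j \<otimes>\<^bsub>I\<^esub> l)) \<oplus>\<^bsub>I\<^esub> (rho b i \<otimes>\<^bsub>I\<^esub> l \<ominus>\<^bsub>I\<^esub> i \<otimes>\<^bsub>I\<^esub> lam b l)) \<oplus>\<^bsub>I\<^esub>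
        ((rho c (lam a j) \<ominus>\<^bsub>I\<^esub> lam a (rho c j)) \<oplus>\<^bsub>I\<^esub> (rho c (rho b i) \<ominus>\<^bsub>I\<^esub> rho (b \<otimes>\<^bsub>B\<^esub> c) i)),
       (a \<otimes>\<^bsub>B\<^esub> b) \<otimes>\<^bsub>B\<^esub> c \<ominus>\<^bsub>B\<^esub> a \<otimes>\<^bsub>B\<^esub> (b \<otimes>\<^bsub>B\<^esub> c))"
      if "i \<in> carrier I" "j \<in> carrier I" "l \<in> carrier I"
        "a \<in> carrier B" "b \<in> carrier B" "c \<in> carrier B" for i j l a b c
      using that
      \<comment> \<open>Distributivity turns each triple product into seven terms; the seven
        differences on the right collapse to one difference of the same sums.\<close>
      by (simp add: S semidirect_sum_minus[OF mI mB] closed lam(3) rho(3)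
          I.mult_add_left I.mult_add_right I.M.minus_add_add[symmetric] I.M.a_ac)
    \<comment> \<open>Rewriting the first bracket on each side by (c) leaves the same two
      differences in opposite order. Condition (b) does the same for the next pair.\<close>
    have "(lam a j \<otimes>\<^bsub>I\<^esub> l \<ominus>\<^bsub>I\<^esub> lam a (j \<otimes>\<^bsub>I\<^esub> l)) \<oplus>\<^bsub>I\<^esub> (rho b i \<otimes>\<^bsub>I\<^esub> l \<ominus>\<^bsub>I\<^esub> i \<otimes>\<^bsub>I\<^esub> lam b l) =
      (lam b i \<otimes>\<^bsub>I\<^esub> l \<ominus>\<^bsub>I\<^esub> lam b (i \<otimes>\<^bsub>I\<^esub> l)) \<oplus>\<^bsub>I\<^esub> (rho a j \<otimes>\<^bsub>I\<^esub> l \<ominus>\<^bsub>I\<^esub> j \<otimes>\<^bsub>I\<^esub> lam a l)"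
      by (simp add: c I.M.a_comm closed)
    moreover have "(rho c (lam a j) \<ominus>\<^bsub>I\<^esub> lam a (rho c j)) \<oplus>\<^bsub>I\<^esub> (rho c (rho b i) \<ominus>\<^bsub>I\<^esub> rho (b \<otimes>\<^bsub>B\<^esub> c) i) =
      (rho c (lam b i) \<ominus>\<^bsub>I\<^esub> lam b (rho c i)) \<oplus>\<^bsub>I\<^esub> (rho c (rho a j) \<ominus>\<^bsub>I\<^esub> rho (a \<otimes>\<^bsub>B\<^esub> c) j)"
      by (simp add: b' I.M.a_comm closed)
    ultimately show "(x \<otimes>\<^bsub>?S\<^esub> y) \<otimes>\<^bsub>?S\<^esub> z \<ominus>\<^bsub>?S\<^esub> x \<otimes>\<^bsub>?S\<^esub> (y \<otimes>\<^bsub>?S\<^esub> z) =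
      (y \<otimes>\<^bsub>?S\<^esub> x) \<otimes>\<^bsub>?S\<^esub> z \<ominus>\<^bsub>?S\<^esub> y \<otimes>\<^bsub>?S\<^esub> (x \<otimes>\<^bsub>?S\<^esub> z)"
      \<comment> \<open>The symmetric identities are instantiated so that each one rewrites only
        from the order \<open>i\<close>, \<open>j\<close> (or \<open>a\<close>, \<open>b\<close>) to
        the exchanged order and never back.\<close>
      by (simp only: xyz expand \<open>i \<in> carrier I\<close> \<open>j \<in> carrier I\<close> \<open>l \<in> carrier I\<close>
          \<open>a \<in> carrier B\<close> \<open>b \<in> carrier B\<close> \<open>c \<in> carrier B\<close>
          I.pre_lie[of i j l] B.pre_lie[of a b c] a'[of a b l] d[of c i j])
  qed
  ultimately show ?thesis
    by (rule pre_lie_algebra.intro)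
qed

end
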